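(* Let $X$ and $Y$ be locally convex topological vector spaces and let $F\colon X\rightrightarrows Y$ be a convex set-valued mapping. Then $$\mathrm{qri}(\mathrm{gph}(F))\supset\{(x,y)\in X\times Y\mid x\in\mathrm{qri}(\mathrm{dom}(F)),\ y\in\mathrm{int}(F(x))\}.$$
   Context: All spaces are real Hausdorff topological vector spaces. A set-valued mapping $F\colon X\rightrightarrows Y$ assigns to each $x\in X$ a (possibly empty) subset $F(x)\subset Y$; $\mathrm{gph}(F):=\{(x,y)\in X\times Y\mid y\in F(x)\}$ and $\mathrm{dom}(F):=\{x\in X\mid F(x)\neq\emptyset\}$. $F$ is called convex if $\mathrm{gph}(F)$ is a convex subset of $X\times Y$. $\mathrm{int}$ denotes the topological interior. For a nonempty subset $S$ of a topological vector space, $\mathrm{cone}(S):=\{tw\mid t\ge 0,\ w\in S\}$ and $\overline{\mathrm{cone}}(S)$ is its closure. For a convex subset $\Omega$ of a topological vector space $Z$, the quasi-relative interior is $\mathrm{qri}(\Omega):=\{x\in\Omega\mid \overline{\mathrm{cone}}(\Omega-x)\text{ is a linear subspace of }Z\}$. *)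

theory Defs
  imports "HOL-Analysis.Analysis"
begin

class hausdorff_tvs = real_vector + topological_ab_group_add + t2_space +
  assumes tendsto_scaleR_nhds:
    "((\<lambda>p. fst p *\<^sub>R snd p) \<longlongrightarrow> c *\<^sub>R x) (nhds (c :: real) \<times>\<^sub>F nhds x)"

text \<open>A class specification cannot mention \<^const>\<open>convex\<close> at its own type, so convexity of
  \<open>V\<close> is written out; see \<open>locally_convex_zero\<close>.\<close>

class hausdorff_lctvs = hausdorff_tvs +
  assumes locally_convex_zero_raw:
    "open U \<Longrightarrow> 0 \<in> U \<Longrightarrow>
      \<exists>V W. (\<forall>x\<in>V. \<forall>y\<in>V. \<forall>u\<ge>0. \<forall>v\<ge>0. u + v = 1 \<longrightarrow> u *\<^sub>R x + v *\<^sub>R y \<in> V)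
        \<and> open W \<and> 0 \<in> W \<and> W \<subseteq> V \<and> V \<subseteq> U"

lemma locally_convex_zero:
  fixes U :: "'a::hausdorff_lctvs set"
  assumes "open U" "0 \<in> U"
  shows "\<exists>V. convex V \<and> 0 \<in> interior V \<and> V \<subseteq> U"
proof -
  obtain V W where V: "convex V" "open W" "0 \<in> W" "W \<subseteq> V" "V \<subseteq> U"
    using locally_convex_zero_raw[OF assms] unfolding convex_def[symmetric] by (elim exE conjE)
  have "0 \<in> interior V"
    using V(2-4) by (rule interiorI)
  with V show ?thesis
    by (intro exI[of _ V] conjI)
qed

lemma continuous_on_scaleR_pair:
  "continuous_on UNIV (\<lambda>(c :: real, x :: 'a::hausdorff_tvs). c *\<^sub>R x)"
  unfolding continuous_on_eq_continuous_within case_prod_beta'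
proof
  fix p :: "real \<times> 'a"
  have "((\<lambda>q. fst q *\<^sub>R snd q) \<longlongrightarrow> fst p *\<^sub>R snd p) (nhds p)"
    using tendsto_scaleR_nhds[of "fst p" "snd p"] by (simp flip: nhds_prod)
  then show "isCont (\<lambda>q. fst q *\<^sub>R snd q) p"
    unfolding isCont_def by (rule tendsto_mono[rotated]) (simp add: at_within_def)
qed

instance prod :: (topological_monoid_add, topological_monoid_add) topological_monoid_add
proof
  fix a b :: "'a \<times> 'b"
  show "((\<lambda>x. fst x + snd x) \<longlongrightarrow> a + b) (nhds a \<times>\<^sub>F nhds b)"
    unfolding plus_prod_def
    by (intro tendsto_intros filterlim_fst filterlim_snd)
qed

instance prod :: (topological_comm_monoid_add, topological_comm_monoid_add)
  topological_comm_monoid_add ..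

instance prod :: (topological_group_add, topological_group_add) topological_group_add
proof
  fix a :: "'a \<times> 'b"
  show "(uminus \<longlongrightarrow> - a) (nhds a)"
    unfolding uminus_prod_def by (intro tendsto_intros filterlim_ident)
qed

instance prod :: (topological_ab_group_add, topological_ab_group_add)
  topological_ab_group_add ..

instance prod :: (hausdorff_tvs, hausdorff_tvs) hausdorff_tvs
proof
  fix c :: real and x :: "'a \<times> 'b"
  have 1: "((\<lambda>p. fst p *\<^sub>R fst (snd p)) \<longlongrightarrow> c *\<^sub>R fst x) (nhds c \<times>\<^sub>F nhds x)"
    using filterlim_compose[OF tendsto_scaleR_nhds filterlim_Pair[OF filterlim_fst
        filterlim_compose[OF tendsto_fst[OF filterlim_ident] filterlim_snd]]]
    by simp
  have 2: "((\<lambda>p. fst p *\<^sub>R snd (snd p)) \<longlongrightarrow> c *\<^sub>R snd x) (nhds c \<times>\<^sub>F nhds x)"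
    using filterlim_compose[OF tendsto_scaleR_nhds filterlim_Pair[OF filterlim_fst
        filterlim_compose[OF tendsto_snd[OF filterlim_ident] filterlim_snd]]]
    by simp
  show "((\<lambda>p. fst p *\<^sub>R snd p) \<longlongrightarrow> c *\<^sub>R x) (nhds c \<times>\<^sub>F nhds x)"
    using tendsto_Pair[OF 1 2] by (simp add: scaleR_prod_def)
qed

instance prod :: (hausdorff_lctvs, hausdorff_lctvs) hausdorff_lctvs
proof
  fix U :: "('a \<times> 'b) set"
  assume "open U" "0 \<in> U"
  then obtain A B where "open A" "open B" "0 \<in> A \<times> B" "A \<times> B \<subseteq> U"
    by (rule open_prod_elim)
  then have AB: "open A" "open B" "0 \<in> A" "0 \<in> B" "A \<times> B \<subseteq> U"
    by (simp_all add: zero_prod_def)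
  obtain C where C: "convex C" "0 \<in> interior C" "C \<subseteq> A"
    using locally_convex_zero[OF AB(1,3)] by blast
  obtain D where D: "convex D" "0 \<in> interior D" "D \<subseteq> B"
    using locally_convex_zero[OF AB(2,4)] by blast
  have "\<forall>x\<in>C \<times> D. \<forall>y\<in>C \<times> D. \<forall>u\<ge>0. \<forall>v\<ge>0. u + v = 1 \<longrightarrow> u *\<^sub>R x + v *\<^sub>R y \<in> C \<times> D"
    using convex_Times[OF C(1) D(1)] unfolding convex_def .
  moreover have "open (interior C \<times> interior D)"
    by (intro open_Times open_interior)
  moreover have "0 \<in> interior C \<times> interior D"
    using C D by (simp add: zero_prod_def)
  moreover have "interior C \<times> interior D \<subseteq> C \<times> D"
    by (intro Sigma_mono interior_subset)
  moreover have "C \<times> D \<subseteq> U"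
    using Sigma_mono[OF C(3) D(3)] AB(5) by (rule order_trans)
  ultimately show "\<exists>V W. (\<forall>x\<in>V. \<forall>y\<in>V. \<forall>u\<ge>0. \<forall>v\<ge>0. u + v = 1 \<longrightarrow> u *\<^sub>R x + v *\<^sub>R y \<in> V)
      \<and> open W \<and> 0 \<in> W \<and> W \<subseteq> V \<and> V \<subseteq> U"
    by (intro exI[of _ "C \<times> D"] exI[of _ "interior C \<times> interior D"] conjI)
qed

instance real_normed_vector < hausdorff_lctvs
proof
  show "((\<lambda>p. fst p *\<^sub>R snd p) \<longlongrightarrow> c *\<^sub>R x) (nhds c \<times>\<^sub>F nhds x)" for c and x :: 'a
    by (intro tendsto_scaleR filterlim_fst filterlim_snd)
  fix U :: "'a set"
  assume "open U" "0 \<in> U"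
  then obtain e where e: "e > 0" "ball 0 e \<subseteq> U"
    by (meson open_contains_ball)
  have "\<forall>x\<in>ball 0 e. \<forall>y\<in>ball 0 e. \<forall>u\<ge>0. \<forall>v\<ge>0. u + v = 1 \<longrightarrow> u *\<^sub>R x + v *\<^sub>R y \<in> ball (0::'a) e"
    using convex_ball[of "0::'a" e] unfolding convex_def .
  with e show "\<exists>V W. (\<forall>x\<in>V. \<forall>y\<in>V. \<forall>u\<ge>0. \<forall>v\<ge>0. u + v = 1 \<longrightarrow> u *\<^sub>R x + v *\<^sub>R y \<in> V)
      \<and> open W \<and> 0 \<in> W \<and> W \<subseteq> V \<and> V \<subseteq> U"
    by (intro exI[of _ "ball 0 e"] conjI) simp_all
qed

definition gph :: "('a \<Rightarrow> 'b set) \<Rightarrow> ('a \<times> 'b) set" where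
  "gph F = {(x, y). y \<in> F x}"

definition sv_dom :: "('a \<Rightarrow> 'b set) \<Rightarrow> 'a set" where
  "sv_dom F = {x. F x \<noteq> {}}"

definition convex_map :: "('a::real_vector \<Rightarrow> 'b::real_vector set) \<Rightarrow> bool" where
  "convex_map F \<longleftrightarrow> convex (gph F)"

text \<open>The library predicate \<^const>\<open>cone\<close> says that a set is a cone; this is the cone
  generated by a set.\<close>

definition cone_of :: "'a::real_vector set \<Rightarrow> 'a set" where
  "cone_of S = {t *\<^sub>R w | t w. t \<ge> 0 \<and> w \<in> S}"

text \<open>Meant for convex \<open>\<Omega>\<close> only.\<close>

definition qri :: "'a::hausdorff_tvs set \<Rightarrow> 'a set" where
  "qri \<Omega> = {x \<in> \<Omega>. subspace (closure (cone_of ((\<lambda>w. w - x) ` \<Omega>)))}"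

end

theory Submission
  imports Defs
begin

text \<open>Fix \<open>x \<in> qri (sv_dom F)\<close> and \<open>y \<in> interior (F x)\<close>. The cone generated by
  \<open>gph F - (x, y)\<close> is not merely dense in, but equal to, the product of the cone generated by
  \<open>sv_dom F - x\<close> with the whole space \<open>UNIV\<close>. Indeed, since \<open>y\<close> is interior to \<open>F x\<close>, this cone
  contains every vertical vector \<open>(0, v)\<close>; and since the graph is convex, it is closed under
  addition, so that the second component of any of its elements can be shifted arbitrarily.
  Closures commute with products, and a product of subspaces is a subspace.\<close>

text \<open>Up to the factor \<open>s + t\<close>, the sum of \<open>s *\<^sub>R a\<close> and \<open>t *\<^sub>R b\<close> is a convex combination of
  \<open>a\<close> and \<open>b\<close>.\<close>

lemma cone_of_add:
  assumes "convex S" "a \<in> cone_of S" "b \<in> cone_of S"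
  shows "a + b \<in> cone_of S"
proof -
  obtain s u t w where a: "a = s *\<^sub>R u" "s \<ge> 0" "u \<in> S" and b: "b = t *\<^sub>R w" "t \<ge> 0" "w \<in> S"
    using assms(2,3) unfolding cone_of_def by blast
  show ?thesis
  proof (cases "s + t = 0")
    case True
    with a b have "a + b = 0 *\<^sub>R u"
      by (simp add: add_nonneg_eq_0_iff)
    with a(3) show ?thesis
      unfolding cone_of_def by blast
  next
    case False
    then have pos: "s + t > 0"
      using a(2) b(2) by simp
    have "(s / (s + t)) *\<^sub>R u + (t / (s + t)) *\<^sub>R w \<in> S"
      using assms(1) a b pos by (intro convexD) (simp_all flip: add_divide_distrib)
    moreover have "a + b = (s + t) *\<^sub>R ((s / (s + t)) *\<^sub>R u + (t / (s + t)) *\<^sub>R w)"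
      using pos a b by (simp add: scaleR_right_distrib)
    ultimately show ?thesis
      using pos unfolding cone_of_def by (blast intro: less_imp_le)
  qed
qed

text \<open>Neighbourhoods are absorbing: along the ray from \<open>y\<close> in direction \<open>v\<close>, continuity of scalar
  multiplication keeps the points inside \<open>A\<close> for a short while.\<close>

lemma cone_of_translate_interior:
  fixes y :: "'a::hausdorff_tvs"
  assumes "y \<in> interior A"
  shows "cone_of ((\<lambda>w. w - y) ` A) = UNIV"
proof -
  have "v \<in> cone_of ((\<lambda>w. w - y) ` A)" for v
  proof -
    have "((\<lambda>c. c *\<^sub>R v) \<longlongrightarrow> 0 *\<^sub>R v) (at_right 0)"
      using filterlim_compose[OF tendsto_scaleR_nhds[of 0 v]
          filterlim_Pair[OF tendsto_ident_at tendsto_const]]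
      by simp
    then have "((\<lambda>c. y + c *\<^sub>R v) \<longlongrightarrow> y) (at_right 0)"
      using tendsto_add[OF tendsto_const] by fastforce
    then have "\<forall>\<^sub>F c in at_right 0. y + c *\<^sub>R v \<in> interior A"
      using assms by (rule topological_tendstoD[OF _ open_interior])
    moreover have "\<forall>\<^sub>F c :: real in at_right 0. c > 0"
      by (rule eventually_at_right_less)
    ultimately have "\<forall>\<^sub>F c in at_right 0. c > 0 \<and> y + c *\<^sub>R v \<in> interior A"
      by (simp add: eventually_conj_iff)
    then obtain c where c: "c > 0" "y + c *\<^sub>R v \<in> interior A"
      using eventually_happens'[OF trivial_limit_at_right_real] by blast
    then have "(y + c *\<^sub>R v) - y \<in> (\<lambda>w. w - y) ` A"
      using interior_subset by blast
    moreover have "v = (1 / c) *\<^sub>R ((y + c *\<^sub>R v) - y)"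
      using c(1) by simp
    moreover have "1 / c \<ge> 0"
      using c(1) by simp
    ultimately show ?thesis
      unfolding cone_of_def by blast
  qed
  then show ?thesis
    by blast
qed

text \<open>Below, \<open>(u, v)\<close> with \<open>u\<close> in the cone generated by \<open>sv_dom F - x\<close> is obtained by
  lifting \<open>u\<close> to some \<open>(u, z)\<close> and then adding the vertical vector \<open>(0, v - z)\<close>.\<close>

lemma cone_of_gph:
  fixes F :: "'a::real_vector \<Rightarrow> 'b::hausdorff_tvs set"
  assumes "convex_map F" and y: "y \<in> interior (F x)"
  shows "cone_of ((\<lambda>w. w - (x, y)) ` gph F) = cone_of ((\<lambda>w. w - x) ` sv_dom F) \<times> (UNIV :: 'b set)"
    (is "?C = ?D \<times> _")
proof (intro set_eqI iffI)
  fix p assume "p \<in> ?C"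
  then obtain t a b where "t \<ge> 0" "b \<in> F a" "p = t *\<^sub>R ((a, b) - (x, y))"
    unfolding cone_of_def gph_def by auto
  moreover from this have "a \<in> sv_dom F"
    by (auto simp: sv_dom_def)
  ultimately show "p \<in> ?D \<times> UNIV"
    unfolding cone_of_def by auto
next
  fix p assume "p \<in> ?D \<times> (UNIV :: 'b set)"
  then obtain t a v where t: "t \<ge> 0" "a \<in> sv_dom F" "p = (t *\<^sub>R (a - x), v)"
    unfolding cone_of_def by auto
  then obtain b where b: "b \<in> F a"
    unfolding sv_dom_def by blast
  have "(a, b) - (x, y) \<in> (\<lambda>w. w - (x, y)) ` gph F"
    using b unfolding gph_def by blast
  then have lift: "t *\<^sub>R ((a, b) - (x, y)) \<in> ?C"
    using t(1) unfolding cone_of_def by blast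
  have "v - t *\<^sub>R (b - y) \<in> cone_of ((\<lambda>w. w - y) ` F x)"
    using cone_of_translate_interior[OF y] by simp
  then obtain s c where s: "s \<ge> 0" "c \<in> F x" "v - t *\<^sub>R (b - y) = s *\<^sub>R (c - y)"
    unfolding cone_of_def by blast
  have "(x, c) - (x, y) \<in> (\<lambda>w. w - (x, y)) ` gph F"
    using s(2) unfolding gph_def by blast
  then have vertical: "s *\<^sub>R ((x, c) - (x, y)) \<in> ?C"
    using s(1) unfolding cone_of_def by blast
  have "convex ((\<lambda>w. w - (x, y)) ` gph F)"
    using assms(1) unfolding convex_map_def by (rule convex_translation_subtract)
  then have "t *\<^sub>R ((a, b) - (x, y)) + s *\<^sub>R ((x, c) - (x, y)) \<in> ?C"
    using lift vertical by (rule cone_of_add)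
  also have "t *\<^sub>R ((a, b) - (x, y)) + s *\<^sub>R ((x, c) - (x, y)) = p"
    using t(3) by (simp flip: s(3))
  finally show "p \<in> ?C" .
qed

theorem theorem3p1:
  fixes F :: "'a::hausdorff_lctvs \<Rightarrow> 'b::hausdorff_lctvs set"
  assumes "convex_map F"
  shows "qri (gph F) \<supseteq> {(x, y). x \<in> qri (sv_dom F) \<and> y \<in> interior (F x)}"
proof clarify
  fix x y assume x: "x \<in> qri (sv_dom F)" and y: "y \<in> interior (F x)"
  have "(x, y) \<in> gph F"
    using y interior_subset by (auto simp: gph_def)
  moreover have "subspace (closure (cone_of ((\<lambda>w. w - x) ` sv_dom F)) \<times> (UNIV :: 'b set))"
    using x by (intro subspace_Times subspace_UNIV) (simp add: qri_def)
  ultimately show "(x, y) \<in> qri (gph F)"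
    unfolding qri_def by (simp add: cone_of_gph[OF assms y] closure_Times)
qed

end
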